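(* Let $(X,d)$ be a compact metric space and let $\phi:\mathbb{R}_0^+\times X\to X$ be a continuous semiflow. Then $$\hat{h}_{\mathrm r}(\phi)=\hat{h}_{\mathrm s}(\phi)=h_{top}(\phi).$$
   Context: A semiflow on $X$ is a map $\phi:\mathbb{R}_0^+\times X\to X$, $\phi_t(x)=\phi(t,x)$, with $\phi_0=\mathrm{id}$ and $\phi_{s+t}=\phi_s\circ\phi_t$; in the following definitions it need not be continuous. Definition of $\hat h_{\mathrm r},\hat h_{\mathrm s}$. For $\delta>0$ put $d_\delta^\phi(x,y)=\inf\{d(\phi_s(x),\phi_s(y)):s\in[0,\delta)\}$. For $x\in X$, $\varepsilon,T,\delta>0$ put $\hat B(x,\phi,T,\varepsilon,\delta)=\{y\in X: d_\delta^\phi(\phi_t(x),\phi_t(y))<\varepsilon \text{ for all } t\in[0,T]\}$. A set $F\subseteq X$ is $(\phi,T,\varepsilon,\delta)$-spanning if $X\subset\bigcup_{y\in F}\hat B(y,\phi,T,\varepsilon,\delta)$; a set $E\subseteq X$ is $(\phi,T,\varepsilon,\delta)$-separated if $E\cap\hat B(x,\phi,T,\varepsilon,\delta)=\{x\}$ for all $x\in E$. Let $\hat r(\phi,T,\varepsilon,\delta)=\inf\{|F|:F\text{ is }(\phi,T,\varepsilon,\delta)\text{-spanning}\}$ and $\hat s(\phi,T,\varepsilon,\delta)=\sup\{|E|:E\text{ is }(\phi,T,\varepsilon,\delta)\text{-separated}\}$ (possibly $\infty$, with $\log\infty=\infty$). Define $$\hat h_{\mathrm r}(\phi)=\lim_{\delta\to0^+}\lim_{\varepsilon\to0^+}\limsup_{T\to+\infty}\tfrac1T\log\hat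 r(\phi,T,\varepsilon,\delta),\qquad \hat h_{\mathrm s}(\phi)=\lim_{\delta\to0^+}\lim_{\varepsilon\to0^+}\limsup_{T\to+\infty}\tfrac1T\log\hat s(\phi,T,\varepsilon,\delta)$$ (the limits exist in $[0,\infty]$ by monotonicity). Bowen's entropy. Put $B(x,\phi,T,\varepsilon)=\{y\in X:d(\phi_t(x),\phi_t(y))<\varepsilon\text{ for all }t\in[0,T]\}$, define $(\phi,T,\varepsilon)$-spanning and $(\phi,T,\varepsilon)$-separated sets in the same way with $B(x,\phi,T,\varepsilon)$ in place of $\hat B(x,\phi,T,\varepsilon,\delta)$, let $r(\phi,T,\varepsilon)$ and $s(\phi,T,\varepsilon)$ be the corresponding infimum and supremum of cardinalities, and set $h_{\mathrm r}(\phi)=\lim_{\varepsilon\to0^+}\limsup_{T\to+\infty}\frac1T\log r(\phi,T,\varepsilon)$, $h_{\mathrm s}(\phi)=\lim_{\varepsilon\to0^+}\limsup_{T\to+\infty}\frac1T\log s(\phi,T,\varepsilon)$. For $X$ compact and $\phi$ continuous, Bowen showed $h_{\mathrm r}(\phi)=h_{\mathrm s}(\phi)$, and $h_{top}(\phi)$ denotes this common value. *)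

theory Defs
  imports "HOL-Analysis.Analysis"
begin

text \<open>
  The compact metric space is a subset \<open>X\<close> of a type of class \<open>metric_space\<close>, with metric \<open>dist\<close>.
  A semiflow is a function \<open>\<phi> :: real \<Rightarrow> 'a \<Rightarrow> 'a\<close> of which only the values \<open>\<phi> t x\<close> with \<open>t \<ge> 0\<close> and
  \<open>x \<in> X\<close> matter.
\<close>

definition semiflow :: "'a set \<Rightarrow> (real \<Rightarrow> 'a \<Rightarrow> 'a) \<Rightarrow> bool" where
  "semiflow X \<phi> \<longleftrightarrow>
     (\<forall>t\<ge>0. \<forall>x\<in>X. \<phi> t x \<in> X) \<and>
     (\<forall>x\<in>X. \<phi> 0 x = x) \<and>
     (\<forall>s\<ge>0. \<forall>t\<ge>0. \<forall>x\<in>X. \<phi> (s + t) x = \<phi> s (\<phi> t x))"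

definition continuous_semiflow :: "'a::metric_space set \<Rightarrow> (real \<Rightarrow> 'a \<Rightarrow> 'a) \<Rightarrow> bool" where
  "continuous_semiflow X \<phi> \<longleftrightarrow>
     semiflow X \<phi> \<and> continuous_on ({0..} \<times> X) (\<lambda>(t, x). \<phi> t x)"

definition ecard :: "'b set \<Rightarrow> enat" where
  "ecard F = (if finite F then enat (card F) else \<infinity>)"

text \<open>The value at 0 is only relevant for empty \<open>X\<close>, where all entropies below are \<open>-\<infinity>\<close>.\<close>

definition elog :: "enat \<Rightarrow> ereal" where
  "elog n = (case n of enat k \<Rightarrow> if k = 0 then -\<infinity> else ereal (ln (real k)) | \<infinity> \<Rightarrow> \<infinity>)"

text \<open>
  Spanning and separated sets are defined relative to a family \<open>B\<close> of balls, so that the same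
  definition serves both kinds of dynamical balls below.
\<close>

definition spanning :: "'a set \<Rightarrow> ('a \<Rightarrow> 'a set) \<Rightarrow> 'a set \<Rightarrow> bool" where
  "spanning X B F \<longleftrightarrow> F \<subseteq> X \<and> X \<subseteq> (\<Union>y\<in>F. B y)"

definition separated :: "'a set \<Rightarrow> ('a \<Rightarrow> 'a set) \<Rightarrow> 'a set \<Rightarrow> bool" where
  "separated X B E \<longleftrightarrow> E \<subseteq> X \<and> (\<forall>x\<in>E. E \<inter> B x = {x})"

definition spanning_number :: "'a set \<Rightarrow> ('a \<Rightarrow> 'a set) \<Rightarrow> enat" where
  "spanning_number X B = (INF F\<in>{F. spanning X B F}. ecard F)"

definition separation_number :: "'a set \<Rightarrow> ('a \<Rightarrow> 'a set) \<Rightarrow> enat" where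
  "separation_number X B = (SUP E\<in>{E. separated X B E}. ecard E)"

definition growth_rate :: "(real \<Rightarrow> enat) \<Rightarrow> ereal" where
  "growth_rate N = Limsup at_top (\<lambda>T. ereal (1 / T) * elog (N T))"

definition dyn_ball :: "'a::metric_space set \<Rightarrow> (real \<Rightarrow> 'a \<Rightarrow> 'a) \<Rightarrow> real \<Rightarrow> real \<Rightarrow> 'a \<Rightarrow> 'a set" where
  "dyn_ball X \<phi> T \<epsilon> x = {y \<in> X. \<forall>t\<in>{0..T}. dist (\<phi> t x) (\<phi> t y) < \<epsilon>}"

definition h_r :: "'a::metric_space set \<Rightarrow> (real \<Rightarrow> 'a \<Rightarrow> 'a) \<Rightarrow> ereal" where
  "h_r X \<phi> = Lim (at_right 0) (\<lambda>\<epsilon>. growth_rate (\<lambda>T. spanning_number X (dyn_ball X \<phi> T \<epsilon>)))"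

definition h_s :: "'a::metric_space set \<Rightarrow> (real \<Rightarrow> 'a \<Rightarrow> 'a) \<Rightarrow> ereal" where
  "h_s X \<phi> = Lim (at_right 0) (\<lambda>\<epsilon>. growth_rate (\<lambda>T. separation_number X (dyn_ball X \<phi> T \<epsilon>)))"

text \<open>The common value of \<open>h_r\<close> and \<open>h_s\<close>; see the lemma \<open>h_top_eq\<close> below.\<close>

definition h_top :: "'a::metric_space set \<Rightarrow> (real \<Rightarrow> 'a \<Rightarrow> 'a) \<Rightarrow> ereal" where
  "h_top X \<phi> = (THE h. h = h_r X \<phi> \<and> h = h_s X \<phi>)"

definition dist_hat :: "(real \<Rightarrow> 'a \<Rightarrow> 'a::metric_space) \<Rightarrow> real \<Rightarrow> 'a \<Rightarrow> 'a \<Rightarrow> real" where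
  "dist_hat \<phi> \<delta> x y = (INF s\<in>{0..<\<delta>}. dist (\<phi> s x) (\<phi> s y))"

definition dyn_ball_hat ::
  "'a::metric_space set \<Rightarrow> (real \<Rightarrow> 'a \<Rightarrow> 'a) \<Rightarrow> real \<Rightarrow> real \<Rightarrow> real \<Rightarrow> 'a \<Rightarrow> 'a set" where
  "dyn_ball_hat X \<phi> T \<epsilon> \<delta> x = {y \<in> X. \<forall>t\<in>{0..T}. dist_hat \<phi> \<delta> (\<phi> t x) (\<phi> t y) < \<epsilon>}"

definition h_hat_r :: "'a::metric_space set \<Rightarrow> (real \<Rightarrow> 'a \<Rightarrow> 'a) \<Rightarrow> ereal" where
  "h_hat_r X \<phi> =
     Lim (at_right 0) (\<lambda>\<delta>. Lim (at_right 0) (\<lambda>\<epsilon>.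
       growth_rate (\<lambda>T. spanning_number X (dyn_ball_hat X \<phi> T \<epsilon> \<delta>))))"

definition h_hat_s :: "'a::metric_space set \<Rightarrow> (real \<Rightarrow> 'a \<Rightarrow> 'a) \<Rightarrow> ereal" where
  "h_hat_s X \<phi> =
     Lim (at_right 0) (\<lambda>\<delta>. Lim (at_right 0) (\<lambda>\<epsilon>.
       growth_rate (\<lambda>T. separation_number X (dyn_ball_hat X \<phi> T \<epsilon> \<delta>))))"


text \<open>
  \<open>Lim\<close> is a definite description, meaningful only if the limit exists. We show that all limits
  above exist, by monotonicity, and that the two definitions of Bowen's entropy agree.
\<close>

lemma tendsto_SUP_at_right_0:
  fixes f :: "real \<Rightarrow> ereal"
  assumes mono: "\<And>x y. 0 < x \<Longrightarrow> x \<le> y \<Longrightarrow> f y \<le> f x"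
  shows "(f \<longlongrightarrow> (SUP x\<in>{0<..}. f x)) (at_right 0)"
proof (rule order_tendstoI)
  fix a assume "a < (SUP x\<in>{0<..}. f x)"
  then obtain x where x: "x > 0" "a < f x" by (auto simp: less_SUP_iff)
  have "\<forall>\<^sub>F y in at_right 0. y \<in> {0<..<x}"
    using x(1) by (rule eventually_at_right_real)
  then show "\<forall>\<^sub>F y in at_right 0. a < f y"
    by eventually_elim (use x mono in \<open>force intro: less_le_trans\<close>)
next
  fix a assume a: "(SUP x\<in>{0<..}. f x) < a"
  have "\<forall>\<^sub>F y in at_right 0. y \<in> {0<..<1::real}"
    by (rule eventually_at_right_real) simp
  then show "\<forall>\<^sub>F y in at_right 0. f y < a"
    by eventually_elim (use a in \<open>auto intro: le_less_trans[OF SUP_upper]\<close>)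
qed

lemma Lim_eq_SUP:
  fixes f :: "real \<Rightarrow> ereal"
  assumes "\<And>x y. 0 < x \<Longrightarrow> x \<le> y \<Longrightarrow> f y \<le> f x"
  shows "Lim (at_right 0) f = (SUP x\<in>{0<..}. f x)"
  by (rule tendsto_Lim[OF _ tendsto_SUP_at_right_0]) (use assms in auto)

lemma tendsto_Lim_at_right_0:
  fixes f :: "real \<Rightarrow> ereal"
  assumes "\<And>x y. 0 < x \<Longrightarrow> x \<le> y \<Longrightarrow> f y \<le> f x"
  shows "(f \<longlongrightarrow> Lim (at_right 0) f) (at_right 0)"
  using tendsto_SUP_at_right_0[of f] Lim_eq_SUP[of f] assms by simp

lemma elog_mono: "m \<le> n \<Longrightarrow> elog m \<le> elog n"
  by (cases m; cases n) (auto simp: elog_def)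

lemma growth_rate_mono:
  assumes "\<And>T. T > 0 \<Longrightarrow> M T \<le> N T"
  shows "growth_rate M \<le> growth_rate N"
  unfolding growth_rate_def
proof (rule Limsup_mono)
  show "\<forall>\<^sub>F T in at_top. ereal (1 / T) * elog (M T) \<le> ereal (1 / T) * elog (N T)"
    using eventually_gt_at_top[of "0::real"]
    by eventually_elim (intro ereal_mult_left_mono elog_mono assms, auto)
qed

lemma spanning_number_antimono:
  assumes "\<And>x. x \<in> X \<Longrightarrow> B x \<subseteq> B' x"
  shows "spanning_number X B' \<le> spanning_number X B"
  unfolding spanning_number_def
  by (rule INF_superset_mono) (use assms in \<open>fastforce simp: spanning_def\<close>)+

lemma separation_number_antimono:
  assumes "\<And>x. x \<in> X \<Longrightarrow> B x \<subseteq> B' x" "\<And>x. x \<in> X \<Longrightarrow> x \<in> B x"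
  shows "separation_number X B' \<le> separation_number X B"
  unfolding separation_number_def
proof (rule SUP_subset_mono)
  show "{E. separated X B' E} \<subseteq> {E. separated X B E}"
    using assms unfolding separated_def by fast
qed simp

lemma dyn_ball_mono: "\<epsilon> \<le> \<epsilon>' \<Longrightarrow> dyn_ball X \<phi> T \<epsilon> x \<subseteq> dyn_ball X \<phi> T \<epsilon>' x"
  by (force simp: dyn_ball_def)

lemma dyn_ball_self: "\<epsilon> > 0 \<Longrightarrow> x \<in> X \<Longrightarrow> x \<in> dyn_ball X \<phi> T \<epsilon> x"
  by (simp add: dyn_ball_def)

lemma dist_hat_antimono: "0 < \<delta> \<Longrightarrow> \<delta> \<le> \<delta>' \<Longrightarrow> dist_hat \<phi> \<delta>' x y \<le> dist_hat \<phi> \<delta> x y"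
  unfolding dist_hat_def
  by (rule cINF_superset_mono) (auto intro!: bdd_belowI2[of _ 0])

lemma dist_hat_self: "0 < \<delta> \<Longrightarrow> dist_hat \<phi> \<delta> x x = 0"
  by (simp add: dist_hat_def)

lemma dyn_ball_hat_mono:
  assumes "\<epsilon> \<le> \<epsilon>'" "0 < \<delta>" "\<delta> \<le> \<delta>'"
  shows "dyn_ball_hat X \<phi> T \<epsilon> \<delta> x \<subseteq> dyn_ball_hat X \<phi> T \<epsilon>' \<delta>' x"
proof
  fix y assume y: "y \<in> dyn_ball_hat X \<phi> T \<epsilon> \<delta> x"
  have "dist_hat \<phi> \<delta>' (\<phi> t x) (\<phi> t y) < \<epsilon>'" if "t \<in> {0..T}" for t
  proof -
    have "dist_hat \<phi> \<delta>' (\<phi> t x) (\<phi> t y) \<le> dist_hat \<phi> \<delta> (\<phi> t x) (\<phi> t y)"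
      using assms by (intro dist_hat_antimono)
    also have "\<dots> < \<epsilon>" using y that by (simp add: dyn_ball_hat_def)
    finally show ?thesis using assms by simp
  qed
  then show "y \<in> dyn_ball_hat X \<phi> T \<epsilon>' \<delta>' x"
    using y by (simp add: dyn_ball_hat_def)
qed

lemma dyn_ball_hat_self: "\<epsilon> > 0 \<Longrightarrow> \<delta> > 0 \<Longrightarrow> x \<in> X \<Longrightarrow> x \<in> dyn_ball_hat X \<phi> T \<epsilon> \<delta> x"
  by (simp add: dyn_ball_hat_def dist_hat_self)

lemma h_r_tendsto:
  "((\<lambda>\<epsilon>. growth_rate (\<lambda>T. spanning_number X (dyn_ball X \<phi> T \<epsilon>))) \<longlongrightarrow> h_r X \<phi>) (at_right 0)"
  unfolding h_r_def
  by (intro tendsto_Lim_at_right_0 growth_rate_mono spanning_number_antimono dyn_ball_mono)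

lemma h_s_tendsto:
  "((\<lambda>\<epsilon>. growth_rate (\<lambda>T. separation_number X (dyn_ball X \<phi> T \<epsilon>))) \<longlongrightarrow> h_s X \<phi>) (at_right 0)"
  unfolding h_s_def
  by (intro tendsto_Lim_at_right_0 growth_rate_mono separation_number_antimono dyn_ball_mono
      dyn_ball_self)

lemma h_hat_r_inner_mono:
  assumes "0 < \<epsilon>" "\<epsilon> \<le> \<epsilon>'" "0 < \<delta>" "\<delta> \<le> \<delta>'"
  shows "growth_rate (\<lambda>T. spanning_number X (dyn_ball_hat X \<phi> T \<epsilon>' \<delta>'))
       \<le> growth_rate (\<lambda>T. spanning_number X (dyn_ball_hat X \<phi> T \<epsilon> \<delta>))"
  using assms by (intro growth_rate_mono spanning_number_antimono dyn_ball_hat_mono)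

lemma h_hat_s_inner_mono:
  assumes "0 < \<epsilon>" "\<epsilon> \<le> \<epsilon>'" "0 < \<delta>" "\<delta> \<le> \<delta>'"
  shows "growth_rate (\<lambda>T. separation_number X (dyn_ball_hat X \<phi> T \<epsilon>' \<delta>'))
       \<le> growth_rate (\<lambda>T. separation_number X (dyn_ball_hat X \<phi> T \<epsilon> \<delta>))"
  using assms
  by (intro growth_rate_mono separation_number_antimono dyn_ball_hat_mono dyn_ball_hat_self)

lemma h_hat_r_inner_tendsto:
  fixes \<phi> :: "real \<Rightarrow> 'a::metric_space \<Rightarrow> 'a"
  defines "g \<equiv> \<lambda>X \<delta> \<epsilon>. growth_rate (\<lambda>T. spanning_number X (dyn_ball_hat X \<phi> T \<epsilon> \<delta>))"
  assumes "\<delta> > 0"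
  shows "(g X \<delta> \<longlongrightarrow> Lim (at_right 0) (g X \<delta>)) (at_right 0)"
  unfolding g_def using assms(2) by (intro tendsto_Lim_at_right_0 h_hat_r_inner_mono) auto

lemma h_hat_s_inner_tendsto:
  fixes \<phi> :: "real \<Rightarrow> 'a::metric_space \<Rightarrow> 'a"
  defines "g \<equiv> \<lambda>X \<delta> \<epsilon>. growth_rate (\<lambda>T. separation_number X (dyn_ball_hat X \<phi> T \<epsilon> \<delta>))"
  assumes "\<delta> > 0"
  shows "(g X \<delta> \<longlongrightarrow> Lim (at_right 0) (g X \<delta>)) (at_right 0)"
  unfolding g_def using assms(2) by (intro tendsto_Lim_at_right_0 h_hat_s_inner_mono) auto

lemma Lim_Lim_mono:
  fixes g :: "real \<Rightarrow> real \<Rightarrow> ereal"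
  assumes g: "\<And>\<delta> \<delta>' \<epsilon> \<epsilon>'. 0 < \<epsilon> \<Longrightarrow> \<epsilon> \<le> \<epsilon>' \<Longrightarrow> 0 < \<delta> \<Longrightarrow> \<delta> \<le> \<delta>' \<Longrightarrow> g \<delta>' \<epsilon>' \<le> g \<delta> \<epsilon>"
    and "0 < \<delta>" "\<delta> \<le> \<delta>'"
  shows "Lim (at_right 0) (g \<delta>') \<le> Lim (at_right 0) (g \<delta>)"
proof -
  have "Lim (at_right 0) (g \<delta>') = (SUP \<epsilon>\<in>{0<..}. g \<delta>' \<epsilon>)"
    using assms(2,3) by (intro Lim_eq_SUP g) auto
  also have "\<dots> \<le> (SUP \<epsilon>\<in>{0<..}. g \<delta> \<epsilon>)"
    using assms(2,3) by (intro SUP_subset_mono g) auto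
  also have "\<dots> = Lim (at_right 0) (g \<delta>)"
    using assms(2,3) by (intro Lim_eq_SUP[symmetric] g) auto
  finally show ?thesis .
qed

lemma h_hat_r_tendsto:
  "((\<lambda>\<delta>. Lim (at_right 0) (\<lambda>\<epsilon>. growth_rate (\<lambda>T. spanning_number X (dyn_ball_hat X \<phi> T \<epsilon> \<delta>))))
     \<longlongrightarrow> h_hat_r X \<phi>) (at_right 0)"
  unfolding h_hat_r_def by (intro tendsto_Lim_at_right_0 Lim_Lim_mono h_hat_r_inner_mono)

lemma h_hat_s_tendsto:
  "((\<lambda>\<delta>. Lim (at_right 0) (\<lambda>\<epsilon>. growth_rate (\<lambda>T. separation_number X (dyn_ball_hat X \<phi> T \<epsilon> \<delta>))))
     \<longlongrightarrow> h_hat_s X \<phi>) (at_right 0)"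
  unfolding h_hat_s_def by (intro tendsto_Lim_at_right_0 Lim_Lim_mono h_hat_s_inner_mono)

lemma spanning_number_le_separation_number:
  assumes self: "\<And>x. x \<in> X \<Longrightarrow> x \<in> B x"
    and sym: "\<And>x y. x \<in> X \<Longrightarrow> y \<in> X \<Longrightarrow> y \<in> B x \<Longrightarrow> x \<in> B y"
  shows "spanning_number X B \<le> separation_number X B"
proof -
  have sep_insert: "separated X B (insert x E)"
    if E: "separated X B E" and x: "x \<in> X" "x \<notin> (\<Union>y\<in>E. B y)" for x E
    using that self sym unfolding separated_def by blast
  show ?thesis
  proof (cases "\<exists>E. separated X B E \<and> infinite E")
    case True
    then obtain E where "separated X B E" "infinite E" by blast
    then have "separation_number X B \<ge> \<infinity>"
      unfolding separation_number_def by (intro SUP_upper2[of E]) (auto simp: ecard_def)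
    then show ?thesis by simp
  next
    case fin: False
    show ?thesis
    proof (cases "\<exists>E. separated X B E \<and> spanning X B E")
      case True
      then obtain E where E: "separated X B E" "spanning X B E" by blast
      have "spanning_number X B \<le> ecard E"
        unfolding spanning_number_def using E by (intro INF_lower) auto
      also have "\<dots> \<le> separation_number X B"
        unfolding separation_number_def using E by (intro SUP_upper) auto
      finally show ?thesis .
    next
      case False
      have ex: "\<exists>E. separated X B E \<and> finite E \<and> card E = n" for n
      proof (induction n)
        case 0
        have "separated X B {}" by (simp add: separated_def)
        then show ?case by (metis card.empty finite.emptyI)
      next
        case (Suc n)
        then obtain E where E: "separated X B E" "finite E" "card E = n" by blast
        then have "\<not> spanning X B E" "E \<subseteq> X"
          using False by (blast, simp add: separated_def)
        then obtain x where x: "x \<in> X" "x \<notin> (\<Union>y\<in>E. B y)"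
          unfolding spanning_def by blast
        then have "x \<notin> E" using self by blast
        then have "card (insert x E) = Suc n" using E by simp
        then show ?case using sep_insert[OF E(1) x] E(2) by blast
      qed
      have le: "enat n \<le> separation_number X B" for n
      proof -
        obtain E where "separated X B E" "finite E" "card E = n" using ex by blast
        then show ?thesis
          unfolding separation_number_def by (intro SUP_upper2[of E]) (auto simp: ecard_def)
      qed
      have "separation_number X B = \<infinity>"
      proof (cases "separation_number X B")
        case (enat k)
        then show ?thesis using le[of "Suc k"] by simp
      qed
      then show ?thesis by simp
    qed
  qed
qed

lemma separation_number_le_spanning_number:
  assumes half: "\<And>x y z. x \<in> X \<Longrightarrow> y \<in> X \<Longrightarrow> z \<in> X \<Longrightarrow> y \<in> B' x \<Longrightarrow> z \<in> B' x \<Longrightarrow> z \<in> B y"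
  shows "separation_number X B \<le> spanning_number X B'"
  unfolding separation_number_def spanning_number_def
proof (rule SUP_least, rule INF_greatest)
  fix E F assume EF: "E \<in> {E. separated X B E}" "F \<in> {F. spanning X B' F}"
  show "ecard E \<le> ecard F"
  proof (cases "finite F")
    case True
    have "\<forall>x\<in>E. \<exists>y\<in>F. x \<in> B' y" using EF by (auto simp: separated_def spanning_def)
    then obtain f where f: "\<And>x. x \<in> E \<Longrightarrow> f x \<in> F \<and> x \<in> B' (f x)" by metis
    have "inj_on f E"
    proof (rule inj_onI)
      fix x y assume xy: "x \<in> E" "y \<in> E" "f x = f y"
      then have "y \<in> B x"
        using f[of x] f[of y] EF by (intro half[of "f x"]) (auto simp: separated_def spanning_def)
      then show "x = y" using xy EF by (auto simp: separated_def)
    qed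
    moreover have "f ` E \<subseteq> F" using f by auto
    ultimately show ?thesis
      using True by (auto simp: ecard_def dest: inj_on_finite intro: card_inj_on_le)
  qed (simp add: ecard_def)
qed

lemma h_r_eq_h_s: "h_r X \<phi> = h_s X \<phi>"
proof (rule antisym)
  show "h_r X \<phi> \<le> h_s X \<phi>"
  proof (rule tendsto_le[OF _ h_s_tendsto h_r_tendsto])
    have "\<forall>\<^sub>F \<epsilon> in at_right 0. \<epsilon> > (0::real)" by (simp add: eventually_at_right_less)
    then show "\<forall>\<^sub>F \<epsilon> in at_right 0.
      growth_rate (\<lambda>T. spanning_number X (dyn_ball X \<phi> T \<epsilon>))
        \<le> growth_rate (\<lambda>T. separation_number X (dyn_ball X \<phi> T \<epsilon>))"
      by eventually_elim
        (intro growth_rate_mono spanning_number_le_separation_number,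
         auto simp: dyn_ball_def dist_commute)
  qed simp
  have "filterlim (\<lambda>\<epsilon>::real. \<epsilon> / 2) (at_right 0) (at_right 0)"
    by (rule filterlim_at_withinI)
      (auto intro!: tendsto_eq_intros simp: eventually_at_right_less eventually_at_filter)
  from filterlim_compose[OF h_r_tendsto this]
  have r: "((\<lambda>\<epsilon>. growth_rate (\<lambda>T. spanning_number X (dyn_ball X \<phi> T (\<epsilon> / 2)))) \<longlongrightarrow> h_r X \<phi>)
    (at_right 0)" .
  show "h_s X \<phi> \<le> h_r X \<phi>"
  proof (rule tendsto_le[OF _ r h_s_tendsto])
    have "separation_number X (dyn_ball X \<phi> T \<epsilon>) \<le> spanning_number X (dyn_ball X \<phi> T (\<epsilon> / 2))"
      for T \<epsilon>
    proof (rule separation_number_le_spanning_number)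
      fix x y z assume "z \<in> X" "y \<in> dyn_ball X \<phi> T (\<epsilon> / 2) x" "z \<in> dyn_ball X \<phi> T (\<epsilon> / 2) x"
      then show "z \<in> dyn_ball X \<phi> T \<epsilon> y"
        unfolding dyn_ball_def by (blast intro: dist_triangle_half_r)
    qed
    then show "\<forall>\<^sub>F \<epsilon> in at_right 0.
      growth_rate (\<lambda>T. separation_number X (dyn_ball X \<phi> T \<epsilon>))
        \<le> growth_rate (\<lambda>T. spanning_number X (dyn_ball X \<phi> T (\<epsilon> / 2)))"
      by (intro always_eventually allI growth_rate_mono)
  qed simp
qed

lemma h_top_eq: "h_top X \<phi> = h_r X \<phi>" "h_top X \<phi> = h_s X \<phi>"
  by (simp_all add: h_top_def h_r_eq_h_s)

end

theory Submission
  imports Defs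
begin

text \<open>
  Bowen balls are contained in the balls of the same radius defined by \<open>dist_hat\<close>, so only
  \<open>h_r X \<phi> \<le> h_hat_r X \<phi>\<close> needs an argument. By uniform continuity of \<open>\<phi>\<close> on \<open>{0..1} \<times> X\<close>, two
  orbits that are \<open>\<epsilon>\<close>-close at some time stay \<open>\<eta>\<close>-close for the next \<open>\<delta>\<close> units of time. Points in
  the same ball for \<open>dist_hat\<close> are \<open>\<epsilon>\<close>-close at some time of each window \<open>[t, t + \<delta>)\<close> and hence
  \<open>\<eta>\<close>-close on all of \<open>[\<delta>, T]\<close>. On the initial piece \<open>[0, \<delta>]\<close> neither orbit moves by more than \<open>\<eta>\<close>
  if \<open>\<delta>\<close> is small, which is where the limit \<open>\<delta> \<rightarrow> 0\<close> enters.
\<close>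

text \<open>Suprema in place of limits reduce each comparison of entropies to one between growth
  rates at suitably chosen radii.\<close>

lemma h_r_eq_SUP:
  "h_r X \<phi> = (SUP \<epsilon>\<in>{0<..}. growth_rate (\<lambda>T. spanning_number X (dyn_ball X \<phi> T \<epsilon>)))"
  unfolding h_r_def
  by (intro Lim_eq_SUP growth_rate_mono spanning_number_antimono dyn_ball_mono)

lemma h_s_eq_SUP:
  "h_s X \<phi> = (SUP \<epsilon>\<in>{0<..}. growth_rate (\<lambda>T. separation_number X (dyn_ball X \<phi> T \<epsilon>)))"
  unfolding h_s_def
  by (intro Lim_eq_SUP growth_rate_mono separation_number_antimono dyn_ball_mono dyn_ball_self)

lemma Lim_Lim_eq_SUP_SUP:
  fixes g :: "real \<Rightarrow> real \<Rightarrow> ereal"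
  assumes g: "\<And>\<delta> \<delta>' \<epsilon> \<epsilon>'. 0 < \<epsilon> \<Longrightarrow> \<epsilon> \<le> \<epsilon>' \<Longrightarrow> 0 < \<delta> \<Longrightarrow> \<delta> \<le> \<delta>' \<Longrightarrow> g \<delta>' \<epsilon>' \<le> g \<delta> \<epsilon>"
  shows "Lim (at_right 0) (\<lambda>\<delta>. Lim (at_right 0) (g \<delta>)) = (SUP \<delta>\<in>{0<..}. SUP \<epsilon>\<in>{0<..}. g \<delta> \<epsilon>)"
proof -
  have "Lim (at_right 0) (\<lambda>\<delta>. Lim (at_right 0) (g \<delta>)) = (SUP \<delta>\<in>{0<..}. Lim (at_right 0) (g \<delta>))"
    by (intro Lim_eq_SUP Lim_Lim_mono g)
  also have "\<dots> = (SUP \<delta>\<in>{0<..}. SUP \<epsilon>\<in>{0<..}. g \<delta> \<epsilon>)"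
    by (intro SUP_cong refl Lim_eq_SUP g) auto
  finally show ?thesis .
qed

lemma h_hat_r_eq_SUP:
  "h_hat_r X \<phi> = (SUP \<delta>\<in>{0<..}. SUP \<epsilon>\<in>{0<..}.
     growth_rate (\<lambda>T. spanning_number X (dyn_ball_hat X \<phi> T \<epsilon> \<delta>)))"
  unfolding h_hat_r_def by (intro Lim_Lim_eq_SUP_SUP h_hat_r_inner_mono)

lemma h_hat_s_eq_SUP:
  "h_hat_s X \<phi> = (SUP \<delta>\<in>{0<..}. SUP \<epsilon>\<in>{0<..}.
     growth_rate (\<lambda>T. separation_number X (dyn_ball_hat X \<phi> T \<epsilon> \<delta>)))"
  unfolding h_hat_s_def by (intro Lim_Lim_eq_SUP_SUP h_hat_s_inner_mono)

lemma dist_hat_commute: "dist_hat \<phi> \<delta> x y = dist_hat \<phi> \<delta> y x"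
  by (simp add: dist_hat_def dist_commute)

text \<open>Strictness yields an actual time \<open>s\<close>, even where the infimum over the
  half-open window is not attained.\<close>

lemma dist_hat_less_iff:
  assumes "0 < \<delta>"
  shows "dist_hat \<phi> \<delta> x y < \<epsilon> \<longleftrightarrow> (\<exists>s\<in>{0..<\<delta>}. dist (\<phi> s x) (\<phi> s y) < \<epsilon>)"
  unfolding dist_hat_def
  by (rule cINF_less_iff) (use assms in \<open>auto intro!: bdd_belowI2[of _ 0]\<close>)

text \<open>The time \<open>0\<close> lies in every window \<open>{0..<\<delta>}\<close> and serves
  as the witness.\<close>

lemma dyn_ball_subset_dyn_ball_hat:
  assumes "semiflow X \<phi>" "0 < \<delta>" "x \<in> X"
  shows "dyn_ball X \<phi> T \<epsilon> x \<subseteq> dyn_ball_hat X \<phi> T \<epsilon> \<delta> x"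
proof
  fix y assume y: "y \<in> dyn_ball X \<phi> T \<epsilon> x"
  have "dist_hat \<phi> \<delta> (\<phi> t x) (\<phi> t y) < \<epsilon>" if "t \<in> {0..T}" for t
  proof -
    have "\<phi> 0 (\<phi> t x) = \<phi> t x" "\<phi> 0 (\<phi> t y) = \<phi> t y"
      using assms y that by (auto simp: semiflow_def dyn_ball_def)
    then show ?thesis
      using y that assms(2) by (auto simp: dist_hat_less_iff dyn_ball_def intro!: bexI[of _ 0])
  qed
  then show "y \<in> dyn_ball_hat X \<phi> T \<epsilon> \<delta> x"
    using y by (simp add: dyn_ball_def dyn_ball_hat_def)
qed

text \<open>One modulus of uniform continuity on \<open>{0..1} \<times> X\<close> gives both
  estimates: vary only the point, or only the time, starting from \<open>0\<close>.\<close>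

lemma continuous_semiflow_uniform:
  fixes X :: "'a::metric_space set"
  assumes "compact X" "continuous_semiflow X \<phi>" "0 < \<eta>"
  obtains \<rho> where "0 < \<rho>" "\<rho> \<le> 1"
    "\<And>t x y. t \<in> {0..1} \<Longrightarrow> x \<in> X \<Longrightarrow> y \<in> X \<Longrightarrow> dist x y < \<rho> \<Longrightarrow> dist (\<phi> t x) (\<phi> t y) < \<eta>"
    "\<And>t x. t \<in> {0..<\<rho>} \<Longrightarrow> x \<in> X \<Longrightarrow> dist (\<phi> t x) x < \<eta>"
proof -
  have "continuous_on ({0..1} \<times> X) (\<lambda>(t, x). \<phi> t x)"
    using assms(2) by (auto simp: continuous_semiflow_def intro: continuous_on_subset)
  then have "uniformly_continuous_on ({0..1} \<times> X) (\<lambda>(t, x). \<phi> t x)"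
    using assms(1) by (intro compact_uniformly_continuous compact_Times) auto
  then obtain r where r: "0 < r"
    and *: "\<And>p q. p \<in> {0..1} \<times> X \<Longrightarrow> q \<in> {0..1} \<times> X \<Longrightarrow> dist q p < r \<Longrightarrow>
      dist (case q of (t, x) \<Rightarrow> \<phi> t x) (case p of (t, x) \<Rightarrow> \<phi> t x) < \<eta>"
    using assms(3) unfolding uniformly_continuous_on_def by meson
  show ?thesis
  proof
    \<comment> \<open>The cap \<open>1\<close> keeps all times below the modulus inside
      \<open>{0..1}\<close>.\<close>
    show "0 < min r 1" "min r 1 \<le> 1" using r by auto
    show "dist (\<phi> t x) (\<phi> t y) < \<eta>"
      if "t \<in> {0..1}" "x \<in> X" "y \<in> X" "dist x y < min r 1" for t x y
      using *[of "(t, y)" "(t, x)"] that by (auto simp: dist_Pair_Pair)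
    show "dist (\<phi> t x) x < \<eta>" if "t \<in> {0..<min r 1}" "x \<in> X" for t x
    proof -
      have "\<phi> 0 x = x"
        using assms(2) that by (auto simp: continuous_semiflow_def semiflow_def)
      then show ?thesis
        using *[of "(0, x)" "(t, x)"] that by (auto simp: dist_Pair_Pair)
    qed
  qed
qed

text \<open>What matters is that \<open>\<delta>\<close> and \<open>\<epsilon>\<close> depend on
  neither \<open>T\<close> nor \<open>x\<close>, so that the inclusion passes to growth
  rates.\<close>

lemma ex_dyn_ball_hat_subset_dyn_ball:
  fixes X :: "'a::metric_space set"
  assumes "compact X" "continuous_semiflow X \<phi>" "0 < \<eta>"
  obtains \<delta> \<epsilon> where "0 < \<delta>" "0 < \<epsilon>"
    "\<And>T x. 0 \<le> T \<Longrightarrow> x \<in> X \<Longrightarrow> dyn_ball_hat X \<phi> T \<epsilon> \<delta> x \<subseteq> dyn_ball X \<phi> T \<eta> x"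
proof -
  have flow: "\<And>t x. 0 \<le> t \<Longrightarrow> x \<in> X \<Longrightarrow> \<phi> t x \<in> X"
    "\<And>s t x. 0 \<le> s \<Longrightarrow> 0 \<le> t \<Longrightarrow> x \<in> X \<Longrightarrow> \<phi> s (\<phi> t x) = \<phi> (s + t) x"
    using assms(2) by (auto simp: continuous_semiflow_def semiflow_def)
  from continuous_semiflow_uniform[OF assms(1,2), of "\<eta> / 3"] assms(3)
  obtain \<rho> where \<rho>: "0 < \<rho>" "\<rho> \<le> 1"
    and close: "\<And>t x y. t \<in> {0..1} \<Longrightarrow> x \<in> X \<Longrightarrow> y \<in> X \<Longrightarrow> dist x y < \<rho> \<Longrightarrow>
      dist (\<phi> t x) (\<phi> t y) < \<eta> / 3"
    and slow: "\<And>t x. t \<in> {0..<\<rho>} \<Longrightarrow> x \<in> X \<Longrightarrow> dist (\<phi> t x) x < \<eta> / 3"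
    by auto
  \<comment> \<open>Any value strictly between \<open>0\<close> and \<open>\<rho>\<close> would do:
    \<open>slow\<close> is applied to times up to and including \<open>\<delta>\<close>.\<close>
  define \<delta> where "\<delta> = \<rho> / 2"
  have \<delta>: "0 < \<delta>" "\<delta> < \<rho>" using \<rho> by (auto simp: \<delta>_def)
  show ?thesis
  proof (rule that[of \<delta> \<rho>, OF \<delta>(1) \<rho>(1)], rule subsetI)
    fix T :: real and x y
    assume T: "0 \<le> T" and x: "x \<in> X" and y: "y \<in> dyn_ball_hat X \<phi> T \<rho> \<delta> x"
    then have yX: "y \<in> X" by (simp add: dyn_ball_hat_def)
    \<comment> \<open>The close time \<open>t + s\<close> is not known, but flowing on for
      \<open>\<delta> - s\<close> always ends at \<open>t + \<delta>\<close>.\<close>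
    have window: "dist (\<phi> (t + \<delta>) x) (\<phi> (t + \<delta>) y) < \<eta> / 3" if t: "t \<in> {0..T}" for t
    proof -
      have "dist_hat \<phi> \<delta> (\<phi> t x) (\<phi> t y) < \<rho>"
        using y t by (simp add: dyn_ball_hat_def)
      then obtain s where s: "s \<in> {0..<\<delta>}" "dist (\<phi> s (\<phi> t x)) (\<phi> s (\<phi> t y)) < \<rho>"
        using \<delta> by (auto simp: dist_hat_less_iff)
      have "dist (\<phi> (\<delta> - s) (\<phi> s (\<phi> t x))) (\<phi> (\<delta> - s) (\<phi> s (\<phi> t y))) < \<eta> / 3"
        using s t x yX \<delta> \<rho> by (intro close flow) auto
      then show ?thesis
        using s t x yX by (simp add: flow add.commute)
    qed
    have "dist (\<phi> t x) (\<phi> t y) < \<eta>" if t: "t \<in> {0..T}" for t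
    proof (cases "\<delta> \<le> t")
      case True
      then show ?thesis
        using window[of "t - \<delta>"] t \<delta> assms(3) by simp
    next
      case False
      \<comment> \<open>No window starting at a nonnegative time ends at \<open>t\<close>, so the
        orbits are compared at \<open>\<delta>\<close>, the end of the first window. This detour
        costs the three thirds of \<open>\<eta>\<close>.\<close>
      have move: "dist (\<phi> \<delta> z) (\<phi> t z) < \<eta> / 3" if z: "z \<in> X" for z
      proof -
        have "dist (\<phi> (\<delta> - t) (\<phi> t z)) (\<phi> t z) < \<eta> / 3"
          using False t z \<delta> by (intro slow flow) auto
        then show ?thesis
          using False t z by (simp add: flow)
      qed
      have "dist (\<phi> t x) (\<phi> t y)
          \<le> dist (\<phi> \<delta> x) (\<phi> t x) + dist (\<phi> \<delta> x) (\<phi> \<delta> y) + dist (\<phi> \<delta> y) (\<phi> t y)"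
        by metric
      then show ?thesis
        using move[OF x] move[OF yX] window[of 0] T by simp
    qed
    then show "y \<in> dyn_ball X \<phi> T \<eta> x"
      using yX by (simp add: dyn_ball_def)
  qed
qed

lemma h_hat_r_le_h_hat_s: "h_hat_r X \<phi> \<le> h_hat_s X \<phi>"
  unfolding h_hat_r_eq_SUP h_hat_s_eq_SUP
proof (intro SUP_subset_mono order_refl)
  fix \<delta> \<epsilon> :: real assume pos: "\<delta> \<in> {0<..}" "\<epsilon> \<in> {0<..}"
  have "y \<in> dyn_ball_hat X \<phi> T \<epsilon> \<delta> x \<Longrightarrow> x \<in> X \<Longrightarrow> x \<in> dyn_ball_hat X \<phi> T \<epsilon> \<delta> y" for T x y
    by (auto simp: dyn_ball_hat_def dist_hat_commute)
  then show "growth_rate (\<lambda>T. spanning_number X (dyn_ball_hat X \<phi> T \<epsilon> \<delta>))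
      \<le> growth_rate (\<lambda>T. separation_number X (dyn_ball_hat X \<phi> T \<epsilon> \<delta>))"
    using pos by (intro growth_rate_mono spanning_number_le_separation_number)
      (auto intro: dyn_ball_hat_self)
qed

text \<open>Larger balls admit fewer separated sets.\<close>

lemma h_hat_s_le_h_s:
  assumes "semiflow X \<phi>"
  shows "h_hat_s X \<phi> \<le> h_s X \<phi>"
  unfolding h_hat_s_eq_SUP h_s_eq_SUP
proof (intro SUP_least)
  fix \<delta> \<epsilon> :: real assume pos: "\<delta> \<in> {0<..}" "\<epsilon> \<in> {0<..}"
  then have "growth_rate (\<lambda>T. separation_number X (dyn_ball_hat X \<phi> T \<epsilon> \<delta>))
      \<le> growth_rate (\<lambda>T. separation_number X (dyn_ball X \<phi> T \<epsilon>))"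
    by (intro growth_rate_mono separation_number_antimono dyn_ball_subset_dyn_ball_hat
        dyn_ball_self assms) auto
  also have "\<dots> \<le> (SUP \<epsilon>\<in>{0<..}. growth_rate (\<lambda>T. separation_number X (dyn_ball X \<phi> T \<epsilon>)))"
    using pos by (intro SUP_upper)
  finally show "growth_rate (\<lambda>T. separation_number X (dyn_ball_hat X \<phi> T \<epsilon> \<delta>))
      \<le> (SUP \<epsilon>\<in>{0<..}. growth_rate (\<lambda>T. separation_number X (dyn_ball X \<phi> T \<epsilon>)))" .
qed

lemma h_r_le_h_hat_r:
  assumes "compact X" "continuous_semiflow X \<phi>"
  shows "h_r X \<phi> \<le> h_hat_r X \<phi>"
  unfolding h_r_eq_SUP
proof (rule SUP_least)
  fix \<eta> :: real assume "\<eta> \<in> {0<..}"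
  then obtain \<delta> \<epsilon> where pos: "0 < \<delta>" "0 < \<epsilon>"
    and sub: "\<And>T x. 0 \<le> T \<Longrightarrow> x \<in> X \<Longrightarrow> dyn_ball_hat X \<phi> T \<epsilon> \<delta> x \<subseteq> dyn_ball X \<phi> T \<eta> x"
    using ex_dyn_ball_hat_subset_dyn_ball[OF assms] by auto
  have "growth_rate (\<lambda>T. spanning_number X (dyn_ball X \<phi> T \<eta>))
      \<le> growth_rate (\<lambda>T. spanning_number X (dyn_ball_hat X \<phi> T \<epsilon> \<delta>))"
    by (intro growth_rate_mono spanning_number_antimono sub) auto
  also have "\<dots> \<le> h_hat_r X \<phi>"
    unfolding h_hat_r_eq_SUP using pos by (intro SUP_upper2[of \<delta>] SUP_upper) auto
  finally show "growth_rate (\<lambda>T. spanning_number X (dyn_ball X \<phi> T \<eta>)) \<le> h_hat_r X \<phi>" .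
qed

theorem theorem1:
  fixes X :: "'a::metric_space set" and \<phi> :: "real \<Rightarrow> 'a \<Rightarrow> 'a"
  assumes "compact X"
    and "continuous_semiflow X \<phi>"
  shows "h_hat_r X \<phi> = h_hat_s X \<phi> \<and> h_hat_s X \<phi> = h_top X \<phi>"
proof -
  have "semiflow X \<phi>"
    using assms(2) by (simp add: continuous_semiflow_def)
  then show ?thesis
    \<comment> \<open>The chain from \<open>h_r\<close> through \<open>h_hat_r\<close> and
      \<open>h_hat_s\<close> to \<open>h_s\<close> collapses, because both ends equal
      \<open>h_top\<close>.\<close>
    using h_r_le_h_hat_r[OF assms] h_hat_r_le_h_hat_s[of X \<phi>] h_hat_s_le_h_s[of X \<phi>]
      h_top_eq[of X \<phi>]
    by (metis order.antisym order.trans)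
qed

end
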